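(* Let $n \in \mathbb{N}$ with $n \geq 2$ and let $\mathcal{U} \subseteq \mathcal{P}([n])$ be an up-set with $\#\mathcal{U} \leq 2^{n-1}$. Let $C = 1 + e^{-1}$ and let $t \in \mathbb{N}$ with $t \geq \frac{Cn}{\log_2 n}$. Then for any sets $A_1, \dots, A_t \in \mathcal{U}$ there are indices $i < j$ with $A_i \cap A_j \neq \emptyset$.
   Context: $[n] = \{1,\dots,n\}$, $\mathcal{P}([n])$ its power set, $\#X$ the cardinality. An up-set is a family $\mathcal{U} \subseteq \mathcal{P}([n])$ such that $A \in \mathcal{U}$ and $A \subseteq B \subseteq [n]$ imply $B \in \mathcal{U}$. *)

theory Defs
  imports Complex_Main
begin

definition up_set :: "nat \<Rightarrow> nat set set \<Rightarrow> bool" where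
  "up_set n U \<longleftrightarrow> U \<subseteq> Pow {1..n} \<and>
     (\<forall>A B. A \<in> U \<longrightarrow> A \<subseteq> B \<longrightarrow> B \<subseteq> {1..n} \<longrightarrow> B \<in> U)"

end

theory Submission
  imports Defs "HOL-Library.Disjoint_Sets"
begin

text \<open>Suppose the \<open>A i\<close> are pairwise disjoint, with sizes \<open>a i\<close>. None is empty, since otherwise
  \<open>U\<close> would be the whole power set. Every subset of \<open>[n]\<close> outside \<open>U\<close> contains no \<open>A i\<close>, and by
  disjointness there are at most \<open>2 ^ n * (\<Prod>i. 1 - 2 powr - a i)\<close> such subsets, which is less than
  \<open>2 ^ n * exp (- (\<Sum>i. 2 powr - a i))\<close>. As \<open>\<Sum>i. a i \<le> n\<close>, the tangent line of \<open>2 powr - x\<close> at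
  \<open>x = log 2 n / C\<close> shows that the sum in the exponent is at least \<open>t * n powr (- 1 / C)\<close>, and this
  is at least \<open>ln 2\<close>: the constant \<open>C = 1 + 1 / e\<close> is the one for which the minimum of
  \<open>C * n powr (1 - 1 / C) / ln n\<close> equals 1. So fewer than half of all subsets are outside \<open>U\<close>,
  a contradiction.\<close>

text \<open>Induction on \<open>I\<close>, splitting \<open>B\<close> into
  \<open>B \<inter> A k\<close> and \<open>B - A k\<close>. The first part is a proper subset of
  \<open>A k\<close>, which leaves \<open>2 ^ card (A k) - 1\<close> choices. The second part avoids
  the remaining \<open>A i\<close>, since these are disjoint from \<open>A k\<close>.\<close>

lemma card_subsets_avoiding_disjoint_family:
  fixes A :: "'i \<Rightarrow> 'a set"
  assumes "finite I" "finite V" "\<And>i. i \<in> I \<Longrightarrow> A i \<subseteq> V" "disjoint_family_on A I"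
  shows "real (card {B. B \<subseteq> V \<and> (\<forall>i\<in>I. \<not> A i \<subseteq> B)})
    \<le> 2 ^ card V * (\<Prod>i\<in>I. 1 - 2 powr - real (card (A i)))"
  using assms
proof (induction I arbitrary: V rule: finite_induct)
  case empty
  then show ?case by (simp add: card_Pow flip: Pow_def)
next
  case (insert k I)
  let ?W = "V - A k"
  let ?avoid = "\<lambda>V I. {B. B \<subseteq> V \<and> (\<forall>i\<in>I. \<not> A i \<subseteq> B)}"
  have AkV: "A k \<subseteq> V"
    using insert.prems by blast
  then have finAk: "finite (A k)"
    using insert.prems(1) finite_subset by blast
  have disj: "A i \<inter> A k = {}" if "i \<in> I" for i
    using insert.prems(3) insert.hyps(2) that by (auto simp: disjoint_family_on_def)
  have IH: "real (card (?avoid ?W I))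
      \<le> 2 ^ card ?W * (\<Prod>i\<in>I. 1 - 2 powr - real (card (A i)))"
  proof (rule insert.IH)
    show "A i \<subseteq> ?W" if "i \<in> I" for i
      using insert.prems(2)[of i] disj[OF that] that by blast
    show "disjoint_family_on A I"
      using insert.prems(3) by (auto simp: disjoint_family_on_def)
  qed (use insert.prems in auto)
  let ?f = "\<lambda>B. (B \<inter> A k, B - A k)"
  have "inj_on ?f (?avoid V (insert k I))"
    by (auto simp: inj_on_def)
  moreover have "?f ` ?avoid V (insert k I) \<subseteq> (Pow (A k) - {A k}) \<times> ?avoid ?W I"
    using disj by (fastforce simp: image_subset_iff)
  moreover have fin: "finite ((Pow (A k) - {A k}) \<times> ?avoid ?W I)"
    using finAk insert.prems(1) by (auto intro: finite_subset[of _ "Pow ?W"])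
  ultimately have "card (?avoid V (insert k I)) \<le> card ((Pow (A k) - {A k}) \<times> ?avoid ?W I)"
    by (rule card_inj_on_le)
  also have "\<dots> = (2 ^ card (A k) - 1) * card (?avoid ?W I)"
    using finAk by (simp add: card_cartesian_product card_Pow)
  finally have "real (card (?avoid V (insert k I)))
      \<le> real ((2 ^ card (A k) - 1) * card (?avoid ?W I))"
    by (simp only: of_nat_le_iff)
  also have "\<dots> = (2 ^ card (A k) - 1) * real (card (?avoid ?W I))"
    by (simp add: of_nat_diff)
  also have "\<dots> \<le> (2 ^ card (A k) - 1) *
      (2 ^ card ?W * (\<Prod>i\<in>I. 1 - 2 powr - real (card (A i))))"
    by (rule mult_left_mono[OF IH]) simp
  also have "\<dots> = ((2 ^ card (A k) - 1) * 2 ^ card ?W) *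
      (\<Prod>i\<in>I. 1 - 2 powr - real (card (A i)))"
    by simp
  also have "(2 ^ card (A k) - 1) * 2 ^ card ?W
      = 2 ^ card V * (1 - 2 powr - real (card (A k)))"
  proof -
    have "card V = card (A k) + card ?W"
      using AkV finAk insert.prems(1) by (metis card_Diff_subset card_mono le_add_diff_inverse)
    then show ?thesis
      by (simp add: power_add powr_minus powr_realpow field_simps)
  qed
  finally show ?case
    using insert.hyps by (simp add: mult.assoc)
qed

text \<open>Squaring \<open>1 - x / 2 \<le> exp (- x / 2)\<close> gains the term
  \<open>x\<^sup>2 / 4\<close>, which makes the bound strict. The strictness excludes the boundary
  case where \<open>U\<close> has exactly half of all subsets.\<close>

lemma one_minus_less_exp_minus:
  fixes x :: real
  assumes "0 < x" "x < 1"
  shows "1 - x < exp (- x)"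
proof -
  have "1 - x < (1 - x / 2)\<^sup>2"
    using assms by (simp add: power2_eq_square field_simps)
  also have "\<dots> \<le> (exp (- x / 2))\<^sup>2"
    using assms exp_ge_add_one_self[of "- x / 2"] by (intro power_mono) auto
  also have "\<dots> = exp (- x)"
    by (simp add: power2_eq_square flip: exp_add)
  finally show ?thesis .
qed

text \<open>By convexity \<open>2 powr - x\<close> lies above its tangent at \<open>m\<close>. That
  tangent decreases, so an upper bound on the sum of the \<open>a i\<close> suffices when it is
  summed over \<open>I\<close>.\<close>

lemma sum_two_powr_minus_ge:
  fixes a :: "'i \<Rightarrow> real"
  assumes "(\<Sum>i\<in>I. a i) \<le> real (card I) * m"
  shows "real (card I) * 2 powr - m \<le> (\<Sum>i\<in>I. 2 powr - a i)"
proof -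
  have tangent: "2 powr - m * (1 - (x - m) * ln 2) \<le> 2 powr - x" for x
  proof -
    have "2 powr - x = 2 powr - m * exp (- (x - m) * ln 2)"
      by (simp add: powr_def algebra_simps flip: exp_add)
    moreover have "1 - (x - m) * ln 2 \<le> exp (- (x - m) * ln 2)"
      using exp_ge_add_one_self[of "- (x - m) * ln 2"] by (simp add: algebra_simps)
    ultimately show ?thesis by (simp add: mult_left_mono)
  qed
  have "0 \<le> (real (card I) * m - (\<Sum>i\<in>I. a i)) * ln 2"
    using assms by simp
  then have "real (card I) * 2 powr - m
      \<le> 2 powr - m * (real (card I) + (real (card I) * m - (\<Sum>i\<in>I. a i)) * ln 2)"
    by (subst mult.commute) (rule mult_left_mono, auto)
  also have "\<dots> = (\<Sum>i\<in>I. 2 powr - m * (1 - (a i - m) * ln 2))"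
    by (simp add: sum_subtractf algebra_simps flip: sum_distrib_left sum_distrib_right)
  also have "\<dots> \<le> (\<Sum>i\<in>I. 2 powr - a i)"
    by (intro sum_mono tangent)
  finally show ?thesis .
qed

text \<open>This is \<open>exp 1 * y \<le> exp y\<close> at \<open>y = s * ln x\<close>, with
  equality at \<open>y = 1\<close>.\<close>

lemma ln_le_powr:
  fixes x s :: real
  assumes "0 < x"
  shows "exp 1 * s * ln x \<le> x powr s"
proof -
  have "exp 1 * (s * ln x) \<le> exp 1 * exp (s * ln x - 1)"
    using exp_ge_add_one_self[of "s * ln x - 1"] by simp
  also have "\<dots> = x powr s"
    using assms by (simp add: powr_def flip: exp_add)
  finally show ?thesis by (simp add: mult.assoc)
qed

lemma ln_2_le_mult_powr:
  fixes x t C :: real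
  assumes "1 < x" and C: "C = 1 + exp (- 1)" and t: "C * x / log 2 x \<le> t"
  shows "ln 2 \<le> t * 2 powr - (log 2 x / C)"
proof -
  have Cpos: "0 < C" and C1: "C - 1 = exp (- 1)" using C by (auto intro: add_pos_pos)
  have lx: "0 < ln x" using assms by simp
  define s where "s = 1 - 1 / C"
  \<comment> \<open>The choice of \<open>C\<close> enters here:
    \<open>C * s = C - 1 = exp (- 1)\<close> cancels the factor \<open>exp 1\<close> of
    \<open>ln_le_powr\<close>.\<close>
  have Cs: "C * exp 1 * s = 1"
  proof -
    have "C * exp 1 * s = exp 1 * (C - 1)" using Cpos by (simp add: s_def field_simps)
    also have "\<dots> = 1" unfolding C1 by (simp flip: exp_add)
    finally show ?thesis .
  qed
  have p: "2 powr - (log 2 x / C) = x powr (- 1 / C)"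
    using assms by (simp add: powr_def log_def)
  have "ln 2 = C * (exp 1 * s * ln x) * ln 2 / ln x"
    using Cs lx by (simp add: mult.assoc[symmetric])
  also have "\<dots> \<le> C * x powr s * ln 2 / ln x"
    using ln_le_powr[of x s] assms(1) lx Cpos
    by (intro divide_right_mono mult_right_mono mult_left_mono) auto
  also have "\<dots> = C * x / log 2 x * x powr (- 1 / C)"
  proof -
    have "x powr s = x * x powr (- 1 / C)"
      using assms(1) powr_add[of x 1 "- 1 / C"] by (simp add: s_def)
    then show ?thesis by (simp add: log_def)
  qed
  also have "\<dots> \<le> t * 2 powr - (log 2 x / C)"
    unfolding p by (intro mult_right_mono t) simp
  finally show ?thesis .
qed

theorem theorem3p11:
  fixes n t :: nat and U :: "nat set set" and C :: real and A :: "nat \<Rightarrow> nat set"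
  assumes "n \<ge> 2"
    and "up_set n U"
    and "card U \<le> 2 ^ (n - 1)"
    and "C = 1 + exp (- 1)"
    and "real t \<ge> C * real n / log 2 (real n)"
    and "\<And>i. i \<in> {1..t} \<Longrightarrow> A i \<in> U"
  shows "\<exists>i\<in>{1..t}. \<exists>j\<in>{1..t}. i < j \<and> A i \<inter> A j \<noteq> {}"
proof (rule ccontr)
  assume contr: "\<not> ?thesis"
  let ?V = "{1..n}" and ?I = "{1..t}"
  let ?x = "\<lambda>i. 2 powr - real (card (A i))"
  have disj: "disjoint_family_on A ?I"
    unfolding disjoint_family_on_def using contr by (metis Int_commute linorder_neqE_nat)
  have UV: "U \<subseteq> Pow ?V" and up: "\<And>A B. A \<in> U \<Longrightarrow> A \<subseteq> B \<Longrightarrow> B \<subseteq> ?V \<Longrightarrow> B \<in> U"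
    using assms(2) unfolding up_set_def by blast+
  have AV: "A i \<subseteq> ?V" if "i \<in> ?I" for i using assms(6)[OF that] UV by blast
  have finA: "finite (A i)" if "i \<in> ?I" for i using AV[OF that] finite_subset by blast
  have half: "(2::nat) ^ n = 2 * 2 ^ (n - 1)"
    using assms(1) by (cases n) auto
  have "{} \<notin> U"
  proof
    assume "{} \<in> U"
    then have "U = Pow ?V" using up UV by blast
    then show False using assms(3) half by (simp add: card_Pow)
  qed
  then have card_pos: "0 < card (A i)" if "i \<in> ?I" for i
    using finA[OF that] assms(6)[OF that] by (metis card_gt_0_iff)
  have x: "0 < ?x i" "?x i < 1" if "i \<in> ?I" for i
    using card_pos[OF that] by (auto simp: powr_less_one)
  have Cpos: "0 < C" using assms(4) by (auto intro: add_pos_pos)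
  have lpos: "0 < log 2 (real n)" using assms(1) by simp
  have "0 < C * real n / log 2 (real n)"
    using Cpos lpos assms(1) by simp
  \<comment> \<open>With an empty index set both products below would equal 1 and their comparison
    could not be strict.\<close>
  then have tpos: "0 < t" using assms(5) by linarith
  have "(\<Sum>i\<in>?I. card (A i)) = card (\<Union>i\<in>?I. A i)"
    using disj finA by (subst card_UN_disjoint) (auto simp: disjoint_family_on_def)
  also have "\<dots> \<le> n"
    using card_mono[of ?V "\<Union>i\<in>?I. A i"] AV by (simp add: UN_subset_iff)
  finally have "(\<Sum>i\<in>?I. real (card (A i))) \<le> real n"
    by (metis of_nat_le_iff of_nat_sum)
  \<comment> \<open>The lower bound on \<open>t\<close> says exactly that the average size of the
    \<open>A i\<close> is at most \<open>m = log 2 n / C\<close>.\<close>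
  also have "\<dots> \<le> real t * (log 2 (real n) / C)"
    using assms(5) Cpos lpos by (simp add: field_simps)
  finally have "real t * 2 powr - (log 2 (real n) / C) \<le> (\<Sum>i\<in>?I. ?x i)"
    using sum_two_powr_minus_ge[of "\<lambda>i. real (card (A i))" ?I] by simp
  then have sum_ge: "ln 2 \<le> (\<Sum>i\<in>?I. ?x i)"
    using ln_2_le_mult_powr[of "real n" C "real t"] assms(1,4,5) by simp
  have "(\<Prod>i\<in>?I. 1 - ?x i) < (\<Prod>i\<in>?I. exp (- ?x i))"
    using x tpos one_minus_less_exp_minus by (intro prod_mono_strict) (auto simp: less_imp_le)
  also have "\<dots> = exp (- (\<Sum>i\<in>?I. ?x i))"
    by (simp add: exp_sum sum_negf flip: sum_negf)
  also have "\<dots> \<le> exp (- ln 2)"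
    using sum_ge by simp
  also have "\<dots> = 1 / 2"
    by (simp add: exp_minus)
  finally have prod_less: "(\<Prod>i\<in>?I. 1 - ?x i) < 1 / 2" .
  have "2 ^ (n - 1) \<le> card (Pow ?V) - card U"
    using assms(3) half by (simp add: card_Pow)
  also have "\<dots> = card (Pow ?V - U)"
    using UV by (simp add: card_Diff_subset finite_subset)
  also have "\<dots> \<le> card {B. B \<subseteq> ?V \<and> (\<forall>i\<in>?I. \<not> A i \<subseteq> B)}"
  proof (rule card_mono)
    \<comment> \<open>A subset of \<open>[n]\<close> containing some \<open>A i\<close> would lie in
      the up-set \<open>U\<close>.\<close>
    show "Pow ?V - U \<subseteq> {B. B \<subseteq> ?V \<and> (\<forall>i\<in>?I. \<not> A i \<subseteq> B)}"
      using assms(6) up by blast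
  qed simp
  finally have "real (2 ^ (n - 1)) \<le> real (card {B. B \<subseteq> ?V \<and> (\<forall>i\<in>?I. \<not> A i \<subseteq> B)})"
    by (simp only: of_nat_le_iff)
  also have "\<dots> \<le> 2 ^ card ?V * (\<Prod>i\<in>?I. 1 - ?x i)"
    by (rule card_subsets_avoiding_disjoint_family) (use AV disj in auto)
  also have "\<dots> < 2 ^ card ?V * (1 / 2)"
    using prod_less by (intro mult_strict_left_mono) auto
  also have "\<dots> = real (2 ^ (n - 1))"
    using assms(1) by (cases n) auto
  finally show False by simp
qed

end
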